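(* Let $n,d\geqslant 1$ be integers, let $w_1,\ldots,w_d\in\mathbb{C}\setminus\{0\}$, and let $f_1,\ldots,f_d\in\mathbb{C}^n$ be such that the points $\exp(f_1),\ldots,\exp(f_d)\in\mathbb{C}^n$ are distinct. Let $y_\alpha:=\sum_{k=1}^d w_k(\exp(f_k))^\alpha$ for $\alpha\in\mathbb{N}^n$, $|\alpha|\leqslant 2d$, and let $\mathcal{H}_d(y):=(y_{\alpha+\beta})_{|\alpha|,|\beta|\leqslant d}$. Let $\mathcal{H}_d(y)=X^TX$ be the factorization obtained from the Autonne-Takagi factorization of $\mathcal{H}_d(y)$, where $X$ is a complex matrix with $d$ rows and with columns $x_\alpha\in\mathbb{C}^d$ indexed by $|\alpha|\leqslant d$. Then the shift operators associated to $\mathcal{H}_d(y)$ exist, that is, there exist matrices $T_1,\ldots,T_n\in\mathbb{C}^{d\times d}$ such that $$T_k x_\alpha=x_{\alpha+e_k}\qquad\text{for all } |\alpha|\leqslant d-1,\ 1\leqslant k\leqslant n;$$ moreover they are simultaneously diagonalizable, and they are complex symmetric, i.e. $T_k^T=T_k$ for all $1\leqslant k\leqslant n$.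
   Context: Multi-index notation: for $z\in\mathbb{C}^n$ and $\alpha\in\mathbb{N}^n$, $z^\alpha:=z_1^{\alpha_1}\cdots z_n^{\alpha_n}$ and $|\alpha|:=\sum_{k=1}^n\alpha_k$. For $f_k=(f_{1k},\ldots,f_{nk})^T\in\mathbb{C}^n$, $\exp(f_k):=(\exp(f_{1k}),\ldots,\exp(f_{nk}))^T$ (entrywise exponential). The vector $e_k\in\mathbb{N}^n$ has $1$ in position $k$ and $0$ elsewhere. The superscript $(\cdot)^T$ denotes transpose (without conjugation). Autonne-Takagi factorization: any square complex symmetric matrix $H$ can be written $H=UDU^T$ with $U$ unitary and $D$ diagonal with real nonnegative entries. The number of nonzero diagonal entries of $D$ equals the rank of $H$. The matrix $\mathcal{H}_d(y)$ has rank $d$ in this setting, and $X$ is the matrix $\sqrt{D}\,U^T$ in which only the $d$ rows corresponding to the nonzero diagonal entries of $D$ are kept, so that $\mathcal{H}_d(y)=X^TX$. Equivalently, $y_{\alpha+\beta}=x_\alpha^Tx_\beta$ for all $|\alpha|,|\beta|\leqslant d$. *)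

theory Defs
  imports
    Complex_Main
    "Jordan_Normal_Form.DL_Submatrix"
    "Jordan_Normal_Form.Schur_Decomposition"
begin

(* Positions are counted from 0: the objects indexed by 1,...,n (or 1,...,d) in the mathematics
   are indexed by {..<n} (or {..<d}); the multi-index e_k is unit_vec n k. *)

definition degree_mi :: "nat vec \<Rightarrow> nat" where
  "degree_mi \<alpha> = (\<Sum>i<dim_vec \<alpha>. \<alpha> $ i)"

definition multi_indices :: "nat \<Rightarrow> nat \<Rightarrow> nat vec set" where
  "multi_indices n d = {\<alpha> \<in> carrier_vec n. degree_mi \<alpha> \<le> d}"

definition monom_eval :: "complex vec \<Rightarrow> nat vec \<Rightarrow> complex" where
  "monom_eval z \<alpha> = (\<Prod>i<dim_vec \<alpha>. (z $ i) ^ (\<alpha> $ i))"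

(* The rows and columns of H_d(y) are indexed by multi-indices. Since library matrices have
   numerical positions, idx assigns to each multi-index of degree at most d its position; it is
   meant to be a bijection onto {..<N}, and no particular monomial order is singled out. *)
definition hankel_matrix ::
    "nat \<Rightarrow> nat \<Rightarrow> (nat vec \<Rightarrow> nat) \<Rightarrow> (nat vec \<Rightarrow> complex) \<Rightarrow> complex mat" where
  "hankel_matrix n d idx y =
     (let I = multi_indices n d; N = card I; mi = inv_into I idx
      in mat N N (\<lambda>(i, j). y (mi i + mi j)))"

lemma hankel_matrix_entry:
  assumes "bij_betw idx (multi_indices n d) {..<card (multi_indices n d)}"
    and "\<alpha> \<in> multi_indices n d" and "\<beta> \<in> multi_indices n d"
  shows "hankel_matrix n d idx y $$ (idx \<alpha>, idx \<beta>) = y (\<alpha> + \<beta>)"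
proof -
  have "idx \<alpha> < card (multi_indices n d)" "idx \<beta> < card (multi_indices n d)"
    using assms bij_betwE by blast+
  then show ?thesis
    using assms by (simp add: hankel_matrix_def Let_def bij_betw_inv_into_left)
qed

definition unitary_mat :: "complex mat \<Rightarrow> bool" where
  "unitary_mat U \<longleftrightarrow> square_mat U \<and> inverts_mat U (mat_adjoint U) \<and> inverts_mat (mat_adjoint U) U"

definition autonne_takagi :: "complex mat \<Rightarrow> complex mat \<Rightarrow> real mat \<Rightarrow> bool" where
  "autonne_takagi H U D \<longleftrightarrow>
     (let N = dim_row H in
        H \<in> carrier_mat N N \<and> U \<in> carrier_mat N N \<and> D \<in> carrier_mat N N \<and>
        unitary_mat U \<and> diagonal_mat D \<and> (\<forall>i<N. 0 \<le> D $$ (i, i)) \<and>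
        H = U * map_mat complex_of_real D * transpose_mat U)"

(* The rows of sqrt(D) U^T at the nonzero diagonal entries of D. As D is diagonal and
   nonnegative, sqrt(D) is the entrywise square root. *)
definition takagi_factor :: "complex mat \<Rightarrow> real mat \<Rightarrow> complex mat" where
  "takagi_factor U D =
     submatrix (map_mat (\<lambda>r. complex_of_real (sqrt r)) D * transpose_mat U)
       {i. i < dim_row D \<and> D $$ (i, i) \<noteq> 0} UNIV"

definition simultaneously_diagonalizable :: "nat \<Rightarrow> (nat \<Rightarrow> complex mat) \<Rightarrow> bool" where
  "simultaneously_diagonalizable n T \<longleftrightarrow>
     (\<exists>P Q. \<forall>k<n. \<exists>\<Delta>. diagonal_mat \<Delta> \<and> similar_mat_wit (T k) \<Delta> P Q)"

end

theory Submission
  imports Defs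
begin

text \<open>
  Write \<open>z\<^sub>k = exp f\<^sub>k\<close>, let \<open>V\<close> be the Vandermonde matrix with rows \<open>k < d\<close>, columns \<open>\<alpha>\<close> and
  entries \<open>z\<^sub>k\<^sup>\<alpha>\<close>, and let \<open>W = diag(w\<^sub>k)\<close>. The Hankel matrix then has two symmetric factorizations,
  \<open>X\<^sup>T X = V\<^sup>T W V\<close>. The factor \<open>X\<close> has a right inverse \<open>R\<close>, because \<open>U\<close> is unitary and the rows with
  a zero singular value have been discarded (\<open>takagi_factor_properties\<close>). The transpose of \<open>V\<close> has
  trivial kernel, because monomials of degree at most \<open>d\<close> separate \<open>d\<close> distinct points
  (\<open>monomials_separate_points\<close>).

  Multiplying the two factorizations by \<open>R\<^sup>T\<close> gives \<open>X = C V\<close> with \<open>C = (V R)\<^sup>T W\<close>, and cancelling \<open>V\<close>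
  on both sides of \<open>V\<^sup>T C\<^sup>T C V = V\<^sup>T W V\<close> gives \<open>C\<^sup>T C = W\<close>. Hence \<open>C\<close> is invertible with inverse
  \<open>A = V R\<close>; in particular \<open>X\<close> has exactly \<open>d\<close> rows
  (\<open>symmetric_factorizations_comparable\<close>).

  The columns of \<open>V\<close> are shifted by \<open>Z\<^sub>i = diag(z\<^sub>k\<^sub>i)\<close>, so those of \<open>X = C V\<close> are shifted by
  \<open>T\<^sub>i = C Z\<^sub>i C\<^sup>-\<^sup>1\<close>. This diagonalizes all \<open>T\<^sub>i\<close> at once. Since \<open>C = A\<^sup>T W\<close>, it also reads
  \<open>T\<^sub>i = A\<^sup>T (W Z\<^sub>i) A\<close>, which is visibly symmetric (\<open>diagonal_shift_operator\<close>).
\<close>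

section \<open>Monomials\<close>

lemma zero_mem_multi_indices: "0\<^sub>v n \<in> multi_indices n m"
  by (simp add: multi_indices_def degree_mi_def)

lemma monom_eval_zero [simp]: "monom_eval z (0\<^sub>v n) = 1"
  by (simp add: monom_eval_def)

lemma monom_eval_add:
  assumes "\<alpha> \<in> carrier_vec n" and "\<beta> \<in> carrier_vec n"
  shows "monom_eval z (\<alpha> + \<beta>) = monom_eval z \<alpha> * monom_eval z \<beta>"
  using assms by (simp add: monom_eval_def power_add prod.distrib)

lemma monom_eval_unit_vec:
  assumes "i < n"
  shows "monom_eval z (unit_vec n i) = z $ i"
proof -
  have "monom_eval z (unit_vec n i) = (\<Prod>j<n. if j = i then z $ i else 1)"
    unfolding monom_eval_def using assms by (intro prod.cong) auto
  then show ?thesis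
    using assms by simp
qed

lemma multi_indices_add:
  assumes "\<alpha> \<in> multi_indices n a" and "\<beta> \<in> multi_indices n b"
  shows "\<alpha> + \<beta> \<in> multi_indices n (a + b)"
  using assms by (auto simp: multi_indices_def degree_mi_def sum.distrib)

lemma unit_vec_mem_multi_indices:
  assumes "i < n"
  shows "unit_vec n i \<in> multi_indices n 1"
proof -
  have "(\<Sum>j<n. (unit_vec n i :: nat vec) $ j) = (\<Sum>j<n. if j = i then 1 else 0)"
    using assms by (intro sum.cong) auto
  then show ?thesis
    using assms by (simp add: multi_indices_def degree_mi_def)
qed

text \<open>
  The other points of the relation are eliminated one at a time: if \<open>u\<close> annihilates all
  monomials of degree at most \<open>m + 1\<close> on \<open>K\<close>, then \<open>u\<close> weighted by a coordinate difference
  \<open>z\<^sub>i - z\<^sub>k\<^sub>0\<^sub>i\<close> annihilates all monomials of degree at most \<open>m\<close>, and the point \<open>k\<^sub>0\<close> drops out of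
  the sum. Choosing a coordinate \<open>i\<close> in which \<open>k\<close> and \<open>k\<^sub>0\<close> differ keeps the weight at \<open>k\<close> nonzero.
\<close>

lemma monomials_separate_points:
  fixes z :: "'k \<Rightarrow> complex vec"
  assumes "finite K" and "card K \<le> Suc m" and "inj_on z K"
    and "\<And>k. k \<in> K \<Longrightarrow> z k \<in> carrier_vec n"
    and "\<And>\<alpha>. \<alpha> \<in> multi_indices n m \<Longrightarrow> (\<Sum>k\<in>K. u k * monom_eval (z k) \<alpha>) = 0"
    and "k \<in> K"
  shows "u k = 0"
  using assms
proof (induction m arbitrary: K u)
  case 0
  then have "K = {k}"
    by (metis card_le_Suc0_iff_eq singleton_iff subsetI subset_singletonD empty_iff)
  then show ?case
    using "0.prems"(5)[OF zero_mem_multi_indices] by simp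
next
  case (Suc m)
  show ?case
  proof (cases "K = {k}")
    case True
    then show ?thesis
      using Suc.prems(5)[OF zero_mem_multi_indices] by simp
  next
    case False
    then obtain k0 where k0: "k0 \<in> K" "k0 \<noteq> k"
      using Suc.prems(6) by blast
    then have "z k \<noteq> z k0"
      using Suc.prems(3,6) by (metis inj_on_def)
    then obtain i where i: "i < n" "z k $ i \<noteq> z k0 $ i"
      using Suc.prems(4) k0(1) Suc.prems(6) by (metis carrier_vecD eq_vecI)
    define v where "v l = u l * (z l $ i - z k0 $ i)" for l
    have "v k = 0"
    proof (rule Suc.IH[of "K - {k0}"])
      show "card (K - {k0}) \<le> Suc m"
        using Suc.prems(1,2) k0(1) by simp
      show "inj_on z (K - {k0})"
        using Suc.prems(3) by (rule inj_on_subset) auto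
      fix \<alpha> assume \<alpha>: "\<alpha> \<in> multi_indices n m"
      then have \<alpha>n: "\<alpha> \<in> carrier_vec n"
        by (simp add: multi_indices_def)
      have up: "\<alpha> + unit_vec n i \<in> multi_indices n (Suc m)"
        using multi_indices_add[OF \<alpha> unit_vec_mem_multi_indices[OF i(1)]] by simp
      have low: "\<alpha> \<in> multi_indices n (Suc m)"
        using \<alpha> by (simp add: multi_indices_def)
      have "(\<Sum>l\<in>K - {k0}. v l * monom_eval (z l) \<alpha>) = (\<Sum>l\<in>K. v l * monom_eval (z l) \<alpha>)"
        using Suc.prems(1) by (intro sum.mono_neutral_left) (auto simp: v_def)
      also have "\<dots> = (\<Sum>l\<in>K. u l * monom_eval (z l) (\<alpha> + unit_vec n i))
          - z k0 $ i * (\<Sum>l\<in>K. u l * monom_eval (z l) \<alpha>)"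
        unfolding sum_distrib_left sum_subtractf[symmetric]
        using \<alpha>n i(1)
        by (intro sum.cong) (auto simp: v_def monom_eval_add[of _ n] monom_eval_unit_vec algebra_simps)
      also have "\<dots> = 0"
        using Suc.prems(5)[OF up] Suc.prems(5)[OF low] by simp
      finally show "(\<Sum>l\<in>K - {k0}. v l * monom_eval (z l) \<alpha>) = 0" .
    qed (use Suc.prems k0 in auto)
    then show ?thesis
      using i(2) by (simp add: v_def)
  qed
qed

section \<open>Takagi factors\<close>

lemma bij_betw_pick:
  assumes "finite J"
  shows "bij_betw (pick J) {..<card J} J"
proof -
  have "inj_on (pick J) {..<card J}"
    by (rule inj_onI) (metis lessThan_iff linorder_neqE_nat nat_neq_iff pick_mono_le)
  moreover have "pick J ` {..<card J} \<subseteq> J"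
    by (auto simp: pick_in_set_le)
  ultimately show ?thesis
    using assms by (metis bij_betw_def card_image card_lessThan card_subset_eq)
qed

text \<open>
  The rows of the Takagi factor \<open>X\<close> need not be orthogonal for the bilinear product, but they are for
  the Hermitian one: \<open>X X\<^sup>* = D\<close> restricted to the nonzero diagonal. So \<open>X\<^sup>* D\<^sup>-\<^sup>1\<close> is a right inverse.
  The number \<open>r\<close> of rows is left open here; it is determined later by comparison with a Vandermonde
  factorization.
\<close>

lemma takagi_factor_properties:
  assumes "autonne_takagi H U D" and "H \<in> carrier_mat N N"
  shows "\<exists>r R. takagi_factor U D \<in> carrier_mat r N \<and> R \<in> carrier_mat N r \<and>
    H = transpose_mat (takagi_factor U D) * takagi_factor U D \<and> takagi_factor U D * R = 1\<^sub>m r"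
proof -
  let ?X = "takagi_factor U D"
  have U: "U \<in> carrier_mat N N" and D: "D \<in> carrier_mat N N" and un: "unitary_mat U"
    and diag: "diagonal_mat D" and nonneg: "\<And>i. i < N \<Longrightarrow> 0 \<le> D $$ (i, i)"
    and H: "H = U * map_mat complex_of_real D * transpose_mat U"
    using assms by (auto simp: autonne_takagi_def Let_def)
  define J where "J = {i. i < N \<and> D $$ (i, i) \<noteq> 0}"
  define r where "r = card J"
  define s where "s i = complex_of_real (sqrt (D $$ (i, i)))" for i
  have finJ: "finite J"
    by (simp add: J_def)
  have pick: "bij_betw (pick J) {..<r} J"
    unfolding r_def by (rule bij_betw_pick[OF finJ])
  have pickJ: "pick J a \<in> J" if "a < r" for a
    using pick that by (auto dest: bij_betwE)
  have pickN: "pick J a < N" if "a < r" for a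
    using pickJ[OF that] by (simp add: J_def)
  have s_sq: "s i * s i = complex_of_real (D $$ (i, i))" if "i < N" for i
    using nonneg[OF that] by (simp add: s_def flip: of_real_mult)
  have s_nz: "s i \<noteq> 0" if "i \<in> J" for i
    using that by (simp add: s_def J_def)
  have sqrtD: "map_mat (\<lambda>r. complex_of_real (sqrt r)) D = mat_diag N s"
    using D diag by (intro eq_matI) (auto simp: mat_diag_def s_def diagonal_mat_def)
  have ofD: "map_mat complex_of_real D = mat_diag N (\<lambda>i. s i * s i)"
    using D diag by (intro eq_matI) (auto simp: mat_diag_def s_sq diagonal_mat_def)
  have X: "?X = mat r N (\<lambda>(a, j). s (pick J a) * U $$ (j, pick J a))"
  proof -
    have dims: "card {i. i < N \<and> i \<in> J} = r" "card {j::nat. j < N} = N"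
      "{i. i < dim_row D \<and> D $$ (i, i) \<noteq> 0} = J"
      using D by (auto simp: J_def r_def)
    have "?X = submatrix (mat N N (\<lambda>(i, j). s i * U $$ (j, i))) J UNIV"
      unfolding takagi_factor_def sqrtD dims
      using U by (subst mat_diag_mult_left[of _ _ N]) (auto intro!: arg_cong2[of _ _ _ _ "\<lambda>A J. submatrix A J UNIV"])
    also have "\<dots> = mat r N (\<lambda>(a, j). s (pick J a) * U $$ (j, pick J a))"
      unfolding submatrix_def
      by (intro eq_matI) (auto simp: dims pickN pick_UNIV)
    finally show ?thesis .
  qed
  define R where "R = mat N r (\<lambda>(j, a). cnj (U $$ (j, pick J a)) / s (pick J a))"
  have XX: "H = transpose_mat ?X * ?X"
  proof (rule eq_matI)
    fix i j assume "i < dim_row (transpose_mat ?X * ?X)" "j < dim_col (transpose_mat ?X * ?X)"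
    then have ij: "i < N" "j < N"
      by (auto simp: X)
    have "H $$ (i, j) = (\<Sum>l<N. s l * s l * U $$ (i, l) * U $$ (j, l))"
      unfolding H ofD using U ij
      by (subst mat_diag_mult_right[of _ N])
        (auto simp: scalar_prod_def lessThan_atLeast0 algebra_simps intro!: sum.cong)
    also have "\<dots> = (\<Sum>l\<in>J. s l * s l * U $$ (i, l) * U $$ (j, l))"
      by (rule sum.mono_neutral_right) (auto simp: J_def s_def)
    also have "\<dots> = (\<Sum>a<r. s (pick J a) * s (pick J a) * U $$ (i, pick J a) * U $$ (j, pick J a))"
      using pick by (rule sum.reindex_bij_betw[symmetric])
    also have "\<dots> = (transpose_mat ?X * ?X) $$ (i, j)"
      unfolding X using ij
      by (auto simp: scalar_prod_def lessThan_atLeast0 algebra_simps intro!: sum.cong)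
    finally show "H $$ (i, j) = (transpose_mat ?X * ?X) $$ (i, j)" .
  qed (use assms(2) in \<open>auto simp: X\<close>)
  have orth: "(\<Sum>j<N. cnj (U $$ (j, p)) * U $$ (j, q)) = (if p = q then 1 else 0)"
    if "p < N" "q < N" for p q
  proof -
    have "mat_adjoint U * U = 1\<^sub>m N"
      using un U by (auto simp: unitary_mat_def inverts_mat_def mat_adjoint_def)
    then have "(mat_adjoint U * U) $$ (p, q) = (if p = q then 1 else 0)"
      using that by simp
    moreover have "(mat_adjoint U * U) $$ (p, q) = (\<Sum>j<N. cnj (U $$ (j, p)) * U $$ (j, q))"
      using U that by (auto simp: mat_adjoint_def scalar_prod_def lessThan_atLeast0 intro!: sum.cong)
    ultimately show ?thesis by simp
  qed
  have XR: "?X * R = 1\<^sub>m r"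
  proof (rule eq_matI)
    fix a b assume "a < dim_row (1\<^sub>m r :: complex mat)" "b < dim_col (1\<^sub>m r :: complex mat)"
    then have ab: "a < r" "b < r" by auto
    have "(?X * R) $$ (a, b) = (\<Sum>j<N. s (pick J a) / s (pick J b) *
        (cnj (U $$ (j, pick J b)) * U $$ (j, pick J a)))"
      unfolding X R_def using ab
      by (auto simp: scalar_prod_def lessThan_atLeast0 intro!: sum.cong)
    also have "\<dots> = s (pick J a) / s (pick J b) * (if pick J b = pick J a then 1 else 0)"
      unfolding sum_distrib_left[symmetric] orth[OF pickN[OF ab(2)] pickN[OF ab(1)]] ..
    also have "\<dots> = (if a = b then 1 else 0)"
      using pick ab s_nz[OF pickJ[OF ab(2)]] by (auto simp: bij_betw_def inj_on_def)
    finally show "(?X * R) $$ (a, b) = 1\<^sub>m r $$ (a, b)"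
      using ab by simp
  qed (auto simp: X R_def)
  show ?thesis
    using X XX XR by (intro exI[of _ r] exI[of _ R]) (auto simp: R_def)
qed

section \<open>Comparison of two factorizations of a symmetric matrix\<close>

text \<open>
  The traces of \<open>A C\<close> and \<open>C A\<close> agree, and they are \<open>d\<close> and \<open>r\<close>; this gives invariance of dimension
  by a single exchange of sums.
\<close>

lemma two_sided_inverse_imp_square:
  fixes A C :: "complex mat"
  assumes A: "A \<in> carrier_mat d r" and C: "C \<in> carrier_mat r d"
    and AC: "A * C = 1\<^sub>m d" and CA: "C * A = 1\<^sub>m r"
  shows "r = d"
proof -
  have "complex_of_nat d = (\<Sum>i<d. (A * C) $$ (i, i))"
    unfolding AC by simp
  also have "\<dots> = (\<Sum>i<d. \<Sum>j<r. A $$ (i, j) * C $$ (j, i))"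
    using A C by (auto simp: scalar_prod_def lessThan_atLeast0 intro!: sum.cong)
  also have "\<dots> = (\<Sum>j<r. \<Sum>i<d. A $$ (i, j) * C $$ (j, i))"
    by (rule sum.swap)
  also have "\<dots> = (\<Sum>j<r. (C * A) $$ (j, j))"
    using A C by (auto simp: scalar_prod_def lessThan_atLeast0 mult.commute intro!: sum.cong)
  also have "\<dots> = complex_of_nat r"
    unfolding CA by simp
  finally show ?thesis
    by simp
qed

lemma mult_left_cancel_of_trivial_kernel:
  fixes B :: "'a :: comm_ring_1 mat"
  assumes B: "B \<in> carrier_mat m d"
    and inj: "\<And>u. u \<in> carrier_vec d \<Longrightarrow> B *\<^sub>v u = 0\<^sub>v m \<Longrightarrow> u = 0\<^sub>v d"
    and M: "M \<in> carrier_mat d c" and M': "M' \<in> carrier_mat d c"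
    and eq: "B * M = B * M'"
  shows "M = M'"
proof -
  have "col M j = col M' j" if j: "j < c" for j
  proof -
    have c: "col M j \<in> carrier_vec d" and c': "col M' j \<in> carrier_vec d"
      using M M' by (simp_all add: carrier_vecI)
    have eqj: "B *\<^sub>v col M j = B *\<^sub>v col M' j"
      unfolding col_mult2[OF B M j, symmetric] col_mult2[OF B M' j, symmetric] eq ..
    have "B *\<^sub>v (col M j - col M' j) = B *\<^sub>v col M' j - B *\<^sub>v col M' j"
      unfolding mult_minus_distrib_mat_vec[OF B c c'] eqj ..
    also have "\<dots> = 0\<^sub>v m"
      using B c' by (intro minus_cancel_vec) (rule mult_mat_vec_carrier)
    finally have "col M j - col M' j = 0\<^sub>v d"
      by (intro inj minus_carrier_vec c c')
    then have "col M j $ i = col M' j $ i" if "i < d" for i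
      using that index_minus_vec(1)[of i "col M' j" "col M j"] carrier_vecD[OF c'] by simp
    then show ?thesis
      using carrier_vecD[OF c] carrier_vecD[OF c'] by (intro eq_vecI) simp_all
  qed
  then show ?thesis
    using M M' by (intro mat_col_eqI) auto
qed

text \<open>
  A complex orthogonal change of basis relates any two full-rank factorizations \<open>Y\<^sup>T Y\<close> of one symmetric
  matrix. Here \<open>sqrt(W) V\<close> plays the part of the second factor; keeping \<open>W\<close> outside avoids
  choosing complex square roots, and the orthogonality relation becomes \<open>C = (C\<^sup>-\<^sup>1)\<^sup>T W\<close>.
\<close>

lemma symmetric_factorizations_comparable:
  fixes X V R :: "complex mat"
  assumes X: "X \<in> carrier_mat r N" and V: "V \<in> carrier_mat d N" and R: "R \<in> carrier_mat N r"
    and w: "\<And>k. k < d \<Longrightarrow> w k \<noteq> 0"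
    and eq: "transpose_mat X * X = transpose_mat V * (mat_diag d w * V)"
    and XR: "X * R = 1\<^sub>m r"
    and inj: "\<And>u. u \<in> carrier_vec d \<Longrightarrow> transpose_mat V *\<^sub>v u = 0\<^sub>v N \<Longrightarrow> u = 0\<^sub>v d"
  shows "r = d \<and> (\<exists>C A. C \<in> carrier_mat d d \<and> A \<in> carrier_mat d d \<and> X = C * V \<and>
    C * A = 1\<^sub>m d \<and> A * C = 1\<^sub>m d \<and> C = transpose_mat A * mat_diag d w)"
proof -
  let ?W = "mat_diag d w"
  define A where "A = V * R"
  define C where "C = transpose_mat A * ?W"
  have W: "?W \<in> carrier_mat d d" by simp
  have WT: "transpose_mat ?W = ?W"
    by (intro eq_matI) (auto simp: mat_diag_def)
  have A: "A \<in> carrier_mat d r"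
    using V R by (simp add: A_def)
  then have C: "C \<in> carrier_mat r d"
    unfolding C_def by (metis W mult_carrier_mat transpose_carrier_mat)
  have Xt: "transpose_mat X \<in> carrier_mat N r" and Vt: "transpose_mat V \<in> carrier_mat N d"
    and Rt: "transpose_mat R \<in> carrier_mat r N" and Ct: "transpose_mat C \<in> carrier_mat d r"
    using X V R C by auto
  have WV: "?W * V \<in> carrier_mat d N" and CV: "C * V \<in> carrier_mat r N"
    and RtVt: "transpose_mat R * transpose_mat V \<in> carrier_mat r d"
    using mult_carrier_mat[OF W V] mult_carrier_mat[OF C V] mult_carrier_mat[OF Rt Vt] by auto
  have XCV: "X = C * V"
  proof -
    have "X = transpose_mat (X * R) * X"
      unfolding XR using X by simp
    also have "\<dots> = transpose_mat R * (transpose_mat X * X)"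
      unfolding transpose_mult[OF X R] by (rule assoc_mult_mat[OF Rt Xt X])
    also have "\<dots> = transpose_mat R * transpose_mat V * (?W * V)"
      unfolding eq by (rule assoc_mult_mat[OF Rt Vt WV, symmetric])
    also have "\<dots> = transpose_mat R * transpose_mat V * ?W * V"
      by (rule assoc_mult_mat[OF RtVt W V, symmetric])
    also have "\<dots> = C * V"
      unfolding C_def A_def transpose_mult[OF V R] ..
    finally show ?thesis .
  qed
  have CA: "C * A = 1\<^sub>m r"
    using XR unfolding A_def XCV assoc_mult_mat[OF C V R] .
  have CC: "transpose_mat C * C = ?W"
  proof -
    let ?M = "transpose_mat C * C"
    have M: "?M \<in> carrier_mat d d"
      using Ct C by (rule mult_carrier_mat)
    have MT: "transpose_mat ?M = ?M"
      unfolding transpose_mult[OF Ct C] by simp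
    \<comment> \<open>The kernel hypothesis cancels the outer factor on the left only; transposing brings the
      remaining factor on the right into that position, since both sides are symmetric.\<close>
    have "transpose_mat V * (?M * V) = transpose_mat V * (?W * V)"
      unfolding eq[symmetric] XCV transpose_mult[OF C V]
        assoc_mult_mat[OF Ct C V] assoc_mult_mat[OF Vt Ct CV] ..
    then have "?M * V = ?W * V"
      using mult_left_cancel_of_trivial_kernel[OF Vt inj mult_carrier_mat[OF M V] WV] by blast
    then have "transpose_mat (?M * V) = transpose_mat (?W * V)"
      by simp
    then have "transpose_mat V * ?M = transpose_mat V * ?W"
      unfolding transpose_mult[OF M V] transpose_mult[OF W V] MT WT .
    then show ?thesis
      using mult_left_cancel_of_trivial_kernel[OF Vt inj M W] by blast
  qed
  define L where "L = mat_diag d (\<lambda>k. inverse (w k)) * transpose_mat C"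
  have L: "L \<in> carrier_mat d r"
    unfolding L_def using Ct by (metis mat_diag_dim mult_carrier_mat)
  have "L * C = mat_diag d (\<lambda>k. inverse (w k)) * ?W"
    unfolding L_def CC[symmetric] by (rule assoc_mult_mat[OF mat_diag_dim Ct C])
  also have "\<dots> = 1\<^sub>m d"
    unfolding mat_diag_diag using w by (auto simp: mat_diag_def intro!: eq_matI)
  finally have LC: "L * C = 1\<^sub>m d" .
  \<comment> \<open>A left and a right inverse of the same matrix coincide.\<close>
  have "L = L * (C * A)"
    unfolding CA using L by simp
  also have "\<dots> = L * C * A"
    by (rule assoc_mult_mat[OF L C A, symmetric])
  also have "\<dots> = A"
    unfolding LC using A by simp
  finally have "L = A" .
  then have AC: "A * C = 1\<^sub>m d"
    using LC by simp
  have "r = d"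
    by (rule two_sided_inverse_imp_square[OF A C AC CA])
  then show ?thesis
    using A C XCV CA AC C_def by blast
qed

section \<open>The shift operators\<close>

text \<open>
  Conjugating a diagonal matrix by \<open>C\<close> gives a symmetric matrix because the relation
  \<open>C = (C\<^sup>-\<^sup>1)\<^sup>T W\<close> turns the conjugation into a congruence, and \<open>W\<close> is absorbed into the diagonal
  factor.
\<close>

lemma diagonal_shift_operator:
  fixes A C :: "complex mat"
  assumes C: "C \<in> carrier_mat d d" and A: "A \<in> carrier_mat d d"
    and CA: "C * A = 1\<^sub>m d" and AC: "A * C = 1\<^sub>m d"
    and CW: "C = transpose_mat A * mat_diag d w"
  shows "C * mat_diag d z * A \<in> carrier_mat d d"
    and "similar_mat_wit (C * mat_diag d z * A) (mat_diag d z) C A"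
    and "transpose_mat (C * mat_diag d z * A) = C * mat_diag d z * A"
    and "v \<in> carrier_vec d \<Longrightarrow>
      (C * mat_diag d z * A) *\<^sub>v (C *\<^sub>v v) = C *\<^sub>v vec d (\<lambda>k. z k * v $ k)"
proof -
  let ?Z = "mat_diag d z"
  have Z: "?Z \<in> carrier_mat d d" by simp
  have CZ: "C * ?Z \<in> carrier_mat d d"
    using C Z by (rule mult_carrier_mat)
  show T: "C * ?Z * A \<in> carrier_mat d d"
    using CZ A by (rule mult_carrier_mat)
  show "similar_mat_wit (C * ?Z * A) ?Z C A"
    using CA AC refl T Z C A by (rule similar_mat_witI)
  define E where "E = mat_diag d (\<lambda>k. w k * z k)"
  have E: "E \<in> carrier_mat d d" and ET: "transpose_mat E = E"
    by (auto simp: E_def mat_diag_def)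
  have "C * ?Z = transpose_mat A * E"
    unfolding CW E_def using A
    by (subst assoc_mult_mat[of _ d d _ d _ d]) auto
  then have TE: "C * ?Z * A = transpose_mat A * (E * A)"
    using A E by (simp add: assoc_mult_mat[of _ d d _ d _ d])
  have At: "transpose_mat A \<in> carrier_mat d d" and EA: "E * A \<in> carrier_mat d d"
    using A E by auto
  have "transpose_mat (transpose_mat A * (E * A)) = transpose_mat (E * A) * A"
    unfolding transpose_mult[OF At EA] by simp
  also have "\<dots> = transpose_mat A * E * A"
    unfolding transpose_mult[OF E A] ET ..
  also have "\<dots> = transpose_mat A * (E * A)"
    using At E A by (rule assoc_mult_mat)
  finally show "transpose_mat (C * ?Z * A) = C * ?Z * A"
    unfolding TE .
  assume v: "v \<in> carrier_vec d"
  have "(C * ?Z * A) *\<^sub>v (C *\<^sub>v v) = (C * ?Z) *\<^sub>v (A *\<^sub>v (C *\<^sub>v v))"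
    using C v by (intro assoc_mult_mat_vec[OF CZ A]) auto
  also have "A *\<^sub>v (C *\<^sub>v v) = v"
    using assoc_mult_mat_vec[OF A C v] AC v by simp
  also have "(C * ?Z) *\<^sub>v v = C *\<^sub>v (?Z *\<^sub>v v)"
    using C Z v by (rule assoc_mult_mat_vec)
  also have "?Z *\<^sub>v v = vec d (\<lambda>k. z k * v $ k)"
    using v by (intro eq_vecI)
      (auto simp: mat_diag_def scalar_prod_def if_distrib[of "\<lambda>x. x * _"] cong: if_cong)
  finally show "(C * ?Z * A) *\<^sub>v (C *\<^sub>v v) = C *\<^sub>v vec d (\<lambda>k. z k * v $ k)" .
qed

theorem mainTheorem2:
  fixes n d :: nat
    and w :: "nat \<Rightarrow> complex" and f :: "nat \<Rightarrow> complex vec"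
    and y :: "nat vec \<Rightarrow> complex" and idx :: "nat vec \<Rightarrow> nat"
    and U :: "complex mat" and D :: "real mat" and X :: "complex mat"
  assumes "n \<ge> 1" and "d \<ge> 1"
    and "\<And>k. k < d \<Longrightarrow> w k \<noteq> 0"
    and "\<And>k. k < d \<Longrightarrow> f k \<in> carrier_vec n"
    and "inj_on (\<lambda>k. map_vec exp (f k)) {..<d}"
    and "\<And>\<alpha>. \<alpha> \<in> multi_indices n (2 * d) \<Longrightarrow>
           y \<alpha> = (\<Sum>k<d. w k * monom_eval (map_vec exp (f k)) \<alpha>)"
    and "bij_betw idx (multi_indices n d) {..<card (multi_indices n d)}"
    and "autonne_takagi (hankel_matrix n d idx y) U D"
    and "X = takagi_factor U D"
  shows "X \<in> carrier_mat d (card (multi_indices n d)) \<and>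
    (\<exists>T :: nat \<Rightarrow> complex mat.
       (\<forall>k<n. T k \<in> carrier_mat d d) \<and>
       (\<forall>\<alpha> \<in> multi_indices n (d - 1). \<forall>k<n.
          T k *\<^sub>v col X (idx \<alpha>) = col X (idx (\<alpha> + unit_vec n k))) \<and>
       simultaneously_diagonalizable n T \<and>
       (\<forall>k<n. transpose_mat (T k) = T k))"
proof -
  let ?I = "multi_indices n d"
  let ?H = "hankel_matrix n d idx y"
  define N where "N = card ?I"
  define mi where "mi = inv_into ?I idx"
  define z where "z = (\<lambda>k. map_vec exp (f k))"
  define V where "V = mat d N (\<lambda>(k, j). monom_eval (z k) (mi j))"
  note [simp] = N_def[symmetric]
  have idx: "bij_betw idx ?I {..<N}"
    using assms(7) by simp
  have mi: "mi j \<in> ?I" "idx (mi j) = j" if "j < N" for j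
    using that idx unfolding mi_def
    by (auto simp: bij_betw_def intro!: inv_into_into f_inv_into_f)
  have idxI: "idx \<alpha> < N" "mi (idx \<alpha>) = \<alpha>" if "\<alpha> \<in> ?I" for \<alpha>
    using that idx unfolding mi_def by (auto simp: bij_betw_inv_into_left dest: bij_betwE)
  have zn: "z k \<in> carrier_vec n" if "k < d" for k
    using assms(4)[OF that] by (simp add: z_def)
  have V: "V \<in> carrier_mat d N"
    by (simp add: V_def)
  have H: "?H \<in> carrier_mat N N"
    by (simp add: hankel_matrix_def Let_def)
  obtain r R where X: "X \<in> carrier_mat r N" and R: "R \<in> carrier_mat N r"
    and HX: "?H = transpose_mat X * X" and XR: "X * R = 1\<^sub>m r"
    using takagi_factor_properties[OF assms(8) H] assms(9) by blast
  have HV: "?H = transpose_mat V * (mat_diag d w * V)"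
  proof (rule eq_matI)
    fix i j assume "i < dim_row (transpose_mat V * (mat_diag d w * V))"
      "j < dim_col (transpose_mat V * (mat_diag d w * V))"
    then have ij: "i < N" "j < N"
      using V by auto
    have carr: "mi i \<in> carrier_vec n" "mi j \<in> carrier_vec n"
      using mi(1) ij by (auto simp: multi_indices_def)
    have "mi i + mi j \<in> multi_indices n (2 * d)"
      using multi_indices_add[OF mi(1)[OF ij(1)] mi(1)[OF ij(2)]] by (simp add: mult_2)
    then have "?H $$ (i, j) = (\<Sum>k<d. w k * monom_eval (z k) (mi i + mi j))"
      using ij assms(6) by (simp add: hankel_matrix_def Let_def mi_def[symmetric] z_def)
    also have "\<dots> = (\<Sum>k<d. monom_eval (z k) (mi i) * (w k * monom_eval (z k) (mi j)))"
      using carr by (simp add: monom_eval_add[of _ n] ac_simps)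
    also have "\<dots> = (transpose_mat V * (mat_diag d w * V)) $$ (i, j)"
      unfolding mat_diag_mult_left[OF V] using ij
      by (auto simp: V_def scalar_prod_def lessThan_atLeast0 intro!: sum.cong)
    finally show "?H $$ (i, j) = (transpose_mat V * (mat_diag d w * V)) $$ (i, j)" .
  qed (use H V in auto)
  have inj: "u = 0\<^sub>v d" if u: "u \<in> carrier_vec d" and Vu: "transpose_mat V *\<^sub>v u = 0\<^sub>v N" for u
  proof (rule eq_vecI)
    fix k assume "k < dim_vec (0\<^sub>v d :: complex vec)"
    then have k: "k < d" by simp
    have "u $ k = 0"
    proof (rule monomials_separate_points[of "{..<d}" d z n "\<lambda>k. u $ k"])
      show "inj_on z {..<d}"
        using assms(5) by (simp add: z_def)
      fix \<alpha> assume \<alpha>: "\<alpha> \<in> ?I"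
      have "(\<Sum>k<d. u $ k * monom_eval (z k) \<alpha>) = (transpose_mat V *\<^sub>v u) $ idx \<alpha>"
        using idxI[OF \<alpha>] u
        by (auto simp: V_def scalar_prod_def lessThan_atLeast0 mult.commute intro!: sum.cong)
      then show "(\<Sum>k<d. u $ k * monom_eval (z k) \<alpha>) = 0"
        unfolding Vu using idxI[OF \<alpha>] by simp
    qed (use zn k in auto)
    then show "u $ k = 0\<^sub>v d $ k"
      using k by simp
  qed (use u in auto)
  obtain C A where rd: "r = d" and C: "C \<in> carrier_mat d d" and A: "A \<in> carrier_mat d d"
    and XCV: "X = C * V" and CA: "C * A = 1\<^sub>m d" and AC: "A * C = 1\<^sub>m d"
    and CW: "C = transpose_mat A * mat_diag d w"
    using symmetric_factorizations_comparable[OF X V R assms(3) trans[OF HX[symmetric] HV] XR inj]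
    by blast
  define T where "T i = C * mat_diag d (\<lambda>k. z k $ i) * A" for i
  note shift = diagonal_shift_operator[OF C A CA AC CW]
  have colX: "col X (idx \<alpha>) = C *\<^sub>v vec d (\<lambda>k. monom_eval (z k) \<alpha>)" if "\<alpha> \<in> ?I" for \<alpha>
  proof -
    have "col V (idx \<alpha>) = vec d (\<lambda>k. monom_eval (z k) \<alpha>)"
      using idxI[OF that] by (auto simp: V_def)
    then show ?thesis
      unfolding XCV using col_mult2[OF C V idxI(1)[OF that]] by simp
  qed
  have "T i *\<^sub>v col X (idx \<alpha>) = col X (idx (\<alpha> + unit_vec n i))"
    if \<alpha>: "\<alpha> \<in> multi_indices n (d - 1)" and i: "i < n" for \<alpha> i
  proof -
    have \<alpha>n: "\<alpha> \<in> carrier_vec n" and low: "\<alpha> \<in> ?I"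
      using \<alpha> by (auto simp: multi_indices_def)
    have up: "\<alpha> + unit_vec n i \<in> ?I"
      using multi_indices_add[OF \<alpha> unit_vec_mem_multi_indices[OF i]] assms(2) by simp
    have "vec d (\<lambda>k. z k $ i * vec d (\<lambda>k. monom_eval (z k) \<alpha>) $ k) =
        vec d (\<lambda>k. monom_eval (z k) (\<alpha> + unit_vec n i))"
      using \<alpha>n i by (auto simp: monom_eval_add[of _ n] monom_eval_unit_vec)
    then show ?thesis
      unfolding colX[OF low] colX[OF up] T_def by (subst shift(4)) auto
  qed
  moreover have "simultaneously_diagonalizable n T"
    unfolding simultaneously_diagonalizable_def
  proof (intro exI allI impI conjI)
    fix i
    show "diagonal_mat (mat_diag d (\<lambda>k. z k $ i))"
      by (simp add: diagonal_mat_def mat_diag_def)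
    show "similar_mat_wit (T i) (mat_diag d (\<lambda>k. z k $ i)) C A"
      unfolding T_def by (rule shift(2))
  qed
  ultimately show ?thesis
    using X rd by (intro conjI exI[of _ T]) (auto simp: T_def shift(1,3))
qed

end
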